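(* Let $n\ge 1$. The set $S_n(3\textrm{-}\bar{1}\textrm{-}42,\ 31\textrm{-}\bar{4}\textrm{-}2)$ consists of all reverse patience words in $\mathfrak{S}_n$ having non-intersecting shadow diagrams (i.e., a permutation $\sigma\in\mathfrak{S}_n$ belongs to this set if and only if $\sigma$ is a reverse patience word and no two shadowlines in the $0$th iterate shadow diagram $D^{(0)}(\sigma)$ cross). Moreover, given a permutation $\sigma\in S_n(3\textrm{-}\bar{1}\textrm{-}42,\ 31\textrm{-}\bar{4}\textrm{-}2)$, the values in the bottom rows of $R(\sigma)$ and $S(\sigma)$ increase from left to right.
   Context: $\mathfrak{S}_n$ is the set of permutations of $\{1,\dots,n\}$ written in one-line notation $\sigma=\sigma_1\sigma_2\cdots\sigma_n$. Barred (generalized) patterns: in a generalized pattern, letters not separated by a dash must be matched by entries in adjacent positions of $\sigma$, while letters separated by a dash need not be adjacent. A permutation avoids a barred pattern if every occurrence of the pattern formed by the unbarred letters is part of an occurrence of the full pattern (with the bar removed). Explicitly: (i) $\sigma$ avoids $3\textrm{-}\bar{1}\textrm{-}42$ if for all positions $i<j<j+1\le n$ with $\sigma_{j+1}<\sigma_i<\sigma_j$ there is $p$ with $i<p<j$ and $\sigma_p<\sigma_{j+1}$; (ii) $\sigma$ avoids $31\textrm{-}\bar{4}\textrm{-}2$ if for all positions $i<i+1<k\le n$ with $\sigma_{i+1}<\sigma_k<\sigma_i$ there is $p$ with $i+1<p<k$ and $\sigma_p>\sigma_i$. $S_n(\beta^{(1)},\beta^{(2)})$ is the set of $\sigma\in\mathfrak{S}_n$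 avoiding both patterns. Extended Patience Sorting: given $\sigma = c_1c_2\cdots c_n\in\mathfrak{S}_n$, build insertion piles $R(\sigma)=\{r_1,\dots,r_m\}$ and recording piles $S(\sigma)=\{s_1,\dots,s_m\}$ as follows. Place $c_1$ into a pile $r_1$ by itself and set $s_1=\{1\}$. For $i=2,\dots,n$ in turn, let $d_1,\dots,d_k$ be the cards atop the piles $r_1,\dots,r_k$ already formed. If $c_i>\max\{d_1,\dots,d_k\}$, put $c_i$ into a new right-most pile $r_{k+1}$ by itself and set $s_{k+1}=\{i\}$; otherwise find the left-most card $d_j$ larger than $c_i$, put $c_i$ atop pile $r_j$, and put $i$ at the bottom of pile $s_j$. Piles are listed left to right; the bottom row of a pile configuration is the sequence of bottom cards of its piles, from left to right. The reverse patience word $RPW(R)$ of a pile configuration $R$ is the word obtained by listing the piles from left to right, each pile being read from bottom to top. A reverse patience word in $\mathfrak{S}_n$ is a permutation of the form $RPW(R(\tau))$ for some $\tau\in\mathfrak{S}_n$. Shadow diagram: the (southwest) shadow of $(m,n)\in\mathbb{Z}^2$ is $U(m,n)=\{(x,y)\in\mathbb{R}^2 : x\le m,\ y\le n\}$. The (southwest) shadowline of a finite set of lattice points is the boundary of the union of their shadows. The shadow diagram (0th iterate) $D^{(0)}(\sigma)=\{L^{(0)}_1(\sigma),\dots,L^{(0)}_k(\sigma)\}$ is formed as follows: $L^{(0)}_1(\sigma)$ is the shadowline of those points $(x,y)\in P:=\{(1,\sigma_1),\dots,(n,\sigma_n)\}$ such that $U(x,y)$ contains no other point of $P$; and, while some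 point of $P$ is not contained in $L^{(0)}_1(\sigma)\cup\dots\cup L^{(0)}_j(\sigma)$, letting $A$ be the set of points of $P$ not in this union, $L^{(0)}_{j+1}(\sigma)$ is the shadowline of those $(x,y)\in A$ such that $U(x,y)$ contains no other point of $A$. The shadow diagram is non-intersecting if no two distinct shadowlines in it intersect (cross). *)

theory Defs
  imports "HOL-Analysis.Analysis" "HOL-Combinatorics.Multiset_Permutations"
begin

text \<open>
  A permutation of \<open>{1..n}\<close> is its one-line word, a member of \<open>permutations_of_set {1..n}\<close>.
  Positions are counted from 1, so \<open>entry \<sigma> i\<close> is $\sigma_i$ for \<open>i \<in> {1..length \<sigma>}\<close>.
\<close>

definition entry :: "nat list \<Rightarrow> nat \<Rightarrow> nat"
  where "entry \<sigma> i = \<sigma> ! (i - 1)"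

definition avoids_3_bar1_42 :: "nat list \<Rightarrow> bool"
  where "avoids_3_bar1_42 \<sigma> \<longleftrightarrow>
    (\<forall>i j. 1 \<le> i \<and> i < j \<and> j + 1 \<le> length \<sigma> \<and>
           entry \<sigma> (j + 1) < entry \<sigma> i \<and> entry \<sigma> i < entry \<sigma> j \<longrightarrow>
           (\<exists>p. i < p \<and> p < j \<and> entry \<sigma> p < entry \<sigma> (j + 1)))"

definition avoids_31_bar4_2 :: "nat list \<Rightarrow> bool"
  where "avoids_31_bar4_2 \<sigma> \<longleftrightarrow>
    (\<forall>i k. 1 \<le> i \<and> i + 1 < k \<and> k \<le> length \<sigma> \<and>
           entry \<sigma> (i + 1) < entry \<sigma> k \<and> entry \<sigma> k < entry \<sigma> i \<longrightarrow>
           (\<exists>p. i + 1 < p \<and> p < k \<and> entry \<sigma> i < entry \<sigma> p))"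

definition S_avoid :: "nat \<Rightarrow> nat list set"
  where "S_avoid n =
    {\<sigma> \<in> permutations_of_set {1..n}. avoids_3_bar1_42 \<sigma> \<and> avoids_31_bar4_2 \<sigma>}"

text \<open>
  A pile configuration lists its piles from left to right, and every pile is a list read from
  bottom to top: \<open>hd\<close> is the bottom card and \<open>last\<close> the card on top.
\<close>

type_synonym piles = "nat list list"

text \<open>
  \<open>eps_step (i, c)\<close> processes the card \<open>c\<close> at position \<open>i\<close>. On the empty configuration it
  opens the first pile, so no separate treatment of the first card is needed.
\<close>

definition eps_step :: "nat \<times> nat \<Rightarrow> piles \<times> piles \<Rightarrow> piles \<times> piles"
  where "eps_step = (\<lambda>(i, c) (R, S).
    if R = [] \<or> Max (set (map last R)) < c then (R @ [[c]], S @ [[i]])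
    else (let j = (LEAST j. j < length R \<and> c < last (R ! j))
          in (R[j := R ! j @ [c]], S[j := i # S ! j])))"

definition eps :: "nat list \<Rightarrow> piles \<times> piles"
  where "eps \<sigma> = fold eps_step (List.enumerate 1 \<sigma>) ([], [])"

definition insertion_piles :: "nat list \<Rightarrow> piles"
  where "insertion_piles \<sigma> = fst (eps \<sigma>)"

definition recording_piles :: "nat list \<Rightarrow> piles"
  where "recording_piles \<sigma> = snd (eps \<sigma>)"

definition bottom_row :: "piles \<Rightarrow> nat list"
  where "bottom_row R = map hd R"

definition RPW :: "piles \<Rightarrow> nat list"
  where "RPW R = concat R"

definition reverse_patience_words :: "nat \<Rightarrow> nat list set"
  where "reverse_patience_words n =
    {RPW (insertion_piles \<tau>) | \<tau>. \<tau> \<in> permutations_of_set {1..n}}"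

definition shadow :: "real \<times> real \<Rightarrow> (real \<times> real) set"
  where "shadow p = {(x, y). x \<le> fst p \<and> y \<le> snd p}"

definition shadowline :: "(real \<times> real) set \<Rightarrow> (real \<times> real) set"
  where "shadowline A = frontier (\<Union>p\<in>A. shadow p)"

definition shadow_minimal :: "(real \<times> real) set \<Rightarrow> (real \<times> real) set"
  where "shadow_minimal A = {p \<in> A. shadow p \<inter> A = {p}}"

definition plot :: "nat list \<Rightarrow> (real \<times> real) set"
  where "plot \<sigma> = {(real i, real (entry \<sigma> i)) | i. i \<in> {1..length \<sigma>}}"

text \<open>
  \<open>remaining \<sigma> j\<close> is the set of points of the plot lying on none of the first \<open>j\<close> shadowlines,
  and \<open>shadowline_of \<sigma> j\<close> is $L^{(0)}_{j+1}(\sigma)$. The construction stops at the first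
  \<open>j\<close> with \<open>remaining \<sigma> j = {}\<close>.
\<close>

primrec remaining :: "nat list \<Rightarrow> nat \<Rightarrow> (real \<times> real) set"
  where
    "remaining \<sigma> 0 = plot \<sigma>"
  | "remaining \<sigma> (Suc j) = remaining \<sigma> j - shadowline (shadow_minimal (remaining \<sigma> j))"

definition shadowline_of :: "nat list \<Rightarrow> nat \<Rightarrow> (real \<times> real) set"
  where "shadowline_of \<sigma> j = shadowline (shadow_minimal (remaining \<sigma> j))"

definition shadow_diagram :: "nat list \<Rightarrow> (real \<times> real) set set"
  where "shadow_diagram \<sigma> = {shadowline_of \<sigma> j | j. remaining \<sigma> j \<noteq> {}}"

text \<open>
  Shadowlines extend to infinity to the left and downwards. Crossing is having a common point:
  the segments of two different shadowlines of a permutation lie on different grid lines, so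
  the lines can meet only where a horizontal segment of one passes through a vertical segment
  of the other.
\<close>

definition non_intersecting :: "(real \<times> real) set set \<Rightarrow> bool"
  where "non_intersecting D \<longleftrightarrow> pairwise disjnt D"

end

theory Submission
  imports Defs
begin

text \<open>
  The proof passes through the cutting of a permutation into its maximal decreasing runs. At
  every stage of patience sorting the piles decrease from bottom to top, and the top cards
  increase from left to right. Conversely, any nonempty decreasing piles with increasing tops
  are reproduced when their own reverse patience word is sorted: every card of a pile exceeds
  the tops of all earlier piles, so each pile is rebuilt on the right of the finished ones
  (\<open>eps_concat\<close>). Reverse patience words are therefore the permutations whose decreasing runs
  have increasing last entries, the runs being the insertion piles. Such a word is
  characterised by avoidance of $3\textrm{-}\bar{1}\textrm{-}42$: the bar entry needed between
  the 3 and the descent 42 is the end of the run containing the 3, and a run end that lies too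
  high gives an occurrence of 3-42 without such an entry (\<open>word_avoids_3_bar1_42\<close>,
  \<open>avoids_3_bar1_42_imp_rising_runs\<close>).

  For a word of this kind, the remaining two properties both say that the first entries of
  the runs increase. In the pattern $31\textrm{-}\bar{4}\textrm{-}2$ the descent 31 lies in one
  run and the 2 in a later one, whose first entry can serve as the 4; conversely, a run
  beginning below the beginning of its predecessor is itself the 2 of an occurrence that has
  no 4 (\<open>avoids_31_bar4_2_iff_heads_increase\<close>). In the shadow diagram, the end of a run lies
  southwest of everything after it, so the layers of minimal points are exactly the runs. If
  the first entries increase, the first point of a later run is strictly northeast of all
  points of an earlier one, so one shadowline lies in the interior of the region below the other.
  If they do not, the horizontal ray that ends at the first point of the later run runs into a
  vertical segment of its predecessor's line (\<open>non_intersecting_iff_heads_increase\<close>).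

  The claim on bottom rows follows at once: the bottom cards of the insertion piles are the
  first entries of the runs, and those of the recording piles are the positions at which
  the runs end.
\<close>

section \<open>Extended patience sorting, one card at a time\<close>

lemma eps_snoc: "eps (\<sigma> @ [c]) = eps_step (Suc (length \<sigma>), c) (eps \<sigma>)"
  by (simp add: eps_def enumerate_append_eq)

lemma eps_step_new_pile:
  assumes "\<forall>r\<in>set R. last r < c"
  shows "eps_step (i, c) (R, S) = (R @ [[c]], S @ [[i]])"
  using assms by (cases "R = []") (auto simp: eps_step_def)

lemma eps_step_onto_pile:
  assumes "j < length R" "c < last (R ! j)" "\<And>k. k < j \<Longrightarrow> last (R ! k) \<le> c"
  shows "eps_step (i, c) (R, S) = (R[j := R ! j @ [c]], S[j := i # S ! j])"
proof -
  have least: "(LEAST j. j < length R \<and> c < last (R ! j)) = j"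
    using assms by (intro Least_equality) (auto simp: not_less[symmetric])
  have "last (R ! j) \<le> Max (set (map last R))"
    using assms(1) by (intro Max_ge) auto
  then have "\<not> Max (set (map last R)) < c"
    using assms(2) by linarith
  moreover have "R \<noteq> []" using assms(1) by auto
  ultimately have "\<not> (R = [] \<or> Max (set (map last R)) < c)" by blast
  then show ?thesis by (simp only: eps_step_def prod.case if_False least Let_def)
qed

section \<open>Decreasing runs whose last entries increase\<close>

locale rising_runs =
  fixes R :: piles
  assumes nonempty: "r \<in> set R \<Longrightarrow> r \<noteq> []"
    and decreasing: "r \<in> set R \<Longrightarrow> sorted_wrt (>) r"
    and tops_increase: "sorted_wrt (<) (map last R)"

lemma rising_runs_snoc:
  "rising_runs (Q @ [r]) \<longleftrightarrow>
     rising_runs Q \<and> r \<noteq> [] \<and> sorted_wrt (>) r \<and> (\<forall>q\<in>set Q. last q < last r)"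
  by (auto simp: rising_runs_def sorted_wrt_append)

lemma decreasing_last_le:
  assumes "sorted_wrt (>) r" "x \<in> set r"
  shows "last r \<le> (x :: nat)"
  using assms by (induction r rule: rev_induct) (auto simp: sorted_wrt_append)

text \<open>
  A card goes onto the first pile whose top exceeds it. Earlier tops are smaller than the card
  and later tops are larger than the covered one, so the new top keeps its place in the order;
  distinctness of the cards excludes equality with a top.
\<close>

lemma rising_runs_eps_step:
  assumes "rising_runs R" "c \<notin> set (concat R)"
  shows "rising_runs (fst (eps_step (i, c) (R, S))) \<and>
         mset (concat (fst (eps_step (i, c) (R, S)))) = add_mset c (mset (concat R))"
proof (cases "\<forall>r\<in>set R. last r < c")
  case True
  then show ?thesis using assms by (simp add: eps_step_new_pile rising_runs_snoc)
next
  case False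
  interpret rising_runs R by fact
  have top_ne: "last (R ! k) \<noteq> c" if "k < length R" for k
    using assms(2) last_in_set[OF nonempty[OF nth_mem[OF that]]] nth_mem[OF that] by auto
  from False obtain k where k: "k < length R \<and> c \<le> last (R ! k)"
    by (metis in_set_conv_nth not_le)
  define j where "j = (LEAST k. k < length R \<and> c \<le> last (R ! k))"
  have j: "j < length R" "c \<le> last (R ! j)"
    using LeastI[of "\<lambda>k. k < length R \<and> c \<le> last (R ! k)", OF k] by (auto simp: j_def)
  have c: "c < last (R ! j)" using j top_ne[of j] by simp
  have before: "last (R ! k) < c" if "k < j" for k
    using not_less_Least[of k "\<lambda>k. k < length R \<and> c \<le> last (R ! k)"] that j by (auto simp: j_def)
  have step: "fst (eps_step (i, c) (R, S)) = R[j := R ! j @ [c]]"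
    using eps_step_onto_pile[of j R c i S] j c before by (simp add: less_imp_le)
  have after: "c < last (R ! k)" if "j < k" "k < length R" for k
    using sorted_wrt_nth_less[OF tops_increase, of j k] that c by simp
  have "rising_runs (R[j := R ! j @ [c]])"
  proof
    fix r assume "r \<in> set (R[j := R ! j @ [c]])"
    then have r: "r \<in> set R \<or> r = R ! j @ [c]"
      using set_update_subset_insert by fastforce
    then show "r \<noteq> []" using nonempty by auto
    have "sorted_wrt (>) (R ! j @ [c])"
      using decreasing[OF nth_mem[OF j(1)]] less_le_trans[OF c decreasing_last_le]
      by (simp add: sorted_wrt_append)
    then show "sorted_wrt (>) r" using r decreasing by auto
  next
    show "sorted_wrt (<) (map last (R[j := R ! j @ [c]]))"
      unfolding sorted_wrt_iff_nth_less
    proof (intro allI impI)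
      fix a b assume ab: "a < b" "b < length (map last (R[j := R ! j @ [c]]))"
      have "last (R ! a) < last (R ! b)"
        using sorted_wrt_nth_less[OF tops_increase ab(1)] ab by simp
      then show "map last (R[j := R ! j @ [c]]) ! a < map last (R[j := R ! j @ [c]]) ! b"
        using ab j(1) before[of a] after[of b] by (auto simp: nth_list_update)
    qed
  qed
  moreover have "mset (concat (R[j := R ! j @ [c]])) = add_mset c (mset (concat R))"
  proof -
    have "mset (concat R) = mset (concat (take j R @ R ! j # drop (Suc j) R))"
      using id_take_nth_drop[OF j(1)] by simp
    then show ?thesis using j(1) by (simp add: upd_conv_take_nth_drop)
  qed
  ultimately show ?thesis by (simp add: step)
qed

lemma insertion_piles_rising_runs:
  assumes "distinct \<tau>"
  shows "rising_runs (insertion_piles \<tau>) \<and> mset (concat (insertion_piles \<tau>)) = mset \<tau>"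
  using assms
proof (induction \<tau> rule: rev_induct)
  case Nil
  then show ?case by (simp add: insertion_piles_def eps_def rising_runs_def)
next
  case (snoc c \<tau>)
  then have IH: "rising_runs (insertion_piles \<tau>)" "mset (concat (insertion_piles \<tau>)) = mset \<tau>"
    by auto
  then have "c \<notin> set (concat (insertion_piles \<tau>))"
    using snoc.prems mset_eq_setD[OF IH(2)] by simp
  from rising_runs_eps_step[OF IH(1) this, of "Suc (length \<tau>)" "snd (eps \<tau>)"] IH(2)
  show ?case by (simp add: insertion_piles_def eps_snoc)
qed

text \<open>
  The first card of \<open>r\<close> exceeds all tops and opens a pile. Each further card still exceeds the
  tops of the old piles but not that of the new one, so it lands there. Positions enter a
  recording pile at the bottom, whence the reversal.
\<close>

lemma eps_append_decreasing:
  assumes "eps \<sigma> = (R, S)" "length S = length R"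
    and "\<And>q. q \<in> set R \<Longrightarrow> last q < last r"
    and "r \<noteq> []" "sorted_wrt (>) r"
  shows "eps (\<sigma> @ r) = (R @ [r], S @ [rev [Suc (length \<sigma>)..<Suc (length \<sigma> + length r)]])"
  using assms(3-5)
proof (induction r rule: rev_induct)
  case Nil
  then show ?case by simp
next
  case (snoc c r)
  show ?case
  proof (cases "r = []")
    case True
    then show ?thesis
      using snoc.prems assms(1,2) by (simp add: eps_snoc eps_step_new_pile)
  next
    case False
    have c: "c < last r" using snoc.prems(3) False by (simp add: sorted_wrt_append)
    have low: "last q < c" if "q \<in> set R" for q using snoc.prems(1)[OF that] by simp
    have IH: "eps (\<sigma> @ r) = (R @ [r], S @ [rev [Suc (length \<sigma>)..<Suc (length \<sigma> + length r)]])"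
      using False snoc.prems(3) less_trans[OF low c]
      by (intro snoc.IH) (auto simp: sorted_wrt_append)
    have "eps (\<sigma> @ r @ [c]) = eps_step (Suc (length \<sigma> + length r), c) (eps (\<sigma> @ r))"
      using eps_snoc[of "\<sigma> @ r" c] by simp
    also have "\<dots> = (R @ [r @ [c]], S @ [rev [Suc (length \<sigma>)..<Suc (length \<sigma> + length (r @ [c]))]])"
      unfolding IH using c low assms(2) False
      by (subst eps_step_onto_pile[where j = "length R"])
        (auto simp: nth_append list_update_append Suc_le_eq less_imp_le)
    finally show ?thesis .
  qed
qed

text \<open>
  The bound on \<open>hd s\<close> is what makes the induction work: the bottom of the next recording pile is
  the length of the longer word.
\<close>

lemma eps_concat:
  assumes "rising_runs R"
  shows "\<exists>S. eps (concat R) = (R, S) \<and> length S = length R \<and>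
             sorted_wrt (<) (map hd S) \<and> (\<forall>s\<in>set S. hd s \<le> length (concat R))"
  using assms
proof (induction R rule: rev_induct)
  case Nil
  then show ?case by (simp add: eps_def)
next
  case (snoc r R)
  then have R: "rising_runs R" and r: "r \<noteq> []" "sorted_wrt (>) r"
    and low: "\<And>q. q \<in> set R \<Longrightarrow> last q < last r"
    by (auto simp: rising_runs_snoc)
  from snoc.IH[OF R] obtain S where S: "eps (concat R) = (R, S)" "length S = length R"
    "sorted_wrt (<) (map hd S)" "\<forall>s\<in>set S. hd s \<le> length (concat R)" by blast
  define s where "s = rev [Suc (length (concat R))..<Suc (length (concat R) + length r)]"
  have "hd s = length (concat R) + length r" using r by (cases r) (simp_all add: s_def hd_rev)
  moreover have "eps (concat R @ r) = (R @ [r], S @ [s])"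
    using eps_append_decreasing[OF S(1,2) low r] by (simp add: s_def)
  moreover have "0 < length r" using r by simp
  ultimately show ?case
    using S by (intro exI[of _ "S @ [s]"])
      (auto simp: sorted_wrt_append simp del: length_greater_0_conv length_concat
        intro: order.strict_trans1 trans_le_add1)
qed

text \<open>
  A word with these runs is obtained by sorting the word itself.
\<close>

lemma reverse_patience_words_eq:
  "reverse_patience_words n =
     {concat R | R. rising_runs R \<and> concat R \<in> permutations_of_set {1..n}}"
proof (intro equalityI subsetI)
  fix \<sigma> assume "\<sigma> \<in> reverse_patience_words n"
  then obtain \<tau> where \<tau>: "\<tau> \<in> permutations_of_set {1..n}" "\<sigma> = concat (insertion_piles \<tau>)"
    by (auto simp: reverse_patience_words_def RPW_def)
  note piles = insertion_piles_rising_runs[OF permutations_of_setD(2)[OF \<tau>(1)]]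
  have "\<sigma> \<in> permutations_of_set {1..n}"
    using piles \<tau> by (metis mset_eq_imp_distinct_iff mset_eq_setD
        permutations_of_setD permutations_of_setI)
  then show "\<sigma> \<in> {concat R | R. rising_runs R \<and> concat R \<in> permutations_of_set {1..n}}"
    using piles \<tau>(2) by blast
next
  fix \<sigma> assume "\<sigma> \<in> {concat R | R. rising_runs R \<and> concat R \<in> permutations_of_set {1..n}}"
  then obtain R where R: "rising_runs R" "\<sigma> = concat R" "\<sigma> \<in> permutations_of_set {1..n}" by blast
  then have "RPW (insertion_piles \<sigma>) = \<sigma>"
    using eps_concat[OF R(1)] by (auto simp: RPW_def insertion_piles_def)
  then show "\<sigma> \<in> reverse_patience_words n"
    using R(3) unfolding reverse_patience_words_def by force
qed

section \<open>Positions of the runs\<close>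

context rising_runs
begin

abbreviation word :: "nat list"
  where "word \<equiv> concat R"

text \<open>
  Run \<open>j\<close>, counted from 0, occupies the positions \<open>{start j<..start (Suc j)}\<close>, since positions in
  a word start at 1. Past the last run, \<open>start\<close> stays at the length of the word.
\<close>

definition start :: "nat \<Rightarrow> nat"
  where "start j = length (concat (take j R))"

lemma start_0: "start 0 = 0"
  by (simp add: start_def)

lemma start_ge_length: "length R \<le> j \<Longrightarrow> start j = length word"
  by (simp add: start_def)

lemma start_Suc: "j < length R \<Longrightarrow> start (Suc j) = start j + length (R ! j)"
  by (simp add: start_def take_Suc_conv_app_nth)

lemma start_less_Suc: "j < length R \<Longrightarrow> start j < start (Suc j)"
  using nonempty[OF nth_mem] by (simp add: start_Suc)

lemma start_mono: "j \<le> k \<Longrightarrow> start j \<le> start k"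
proof (induction k rule: dec_induct)
  case (step k)
  then show ?case
    using start_less_Suc[of k] by (cases "k < length R") (auto simp: start_ge_length)
qed simp

lemma start_le_length: "start j \<le> length word"
  using start_mono[of j "max j (length R)"] by (simp add: start_ge_length)

lemma entry_eq:
  assumes "j < length R" "start j < i" "i \<le> start (Suc j)"
  shows "entry word i = R ! j ! (i - start j - 1)"
proof -
  have "word = concat (take j R) @ R ! j @ concat (drop (Suc j) R)"
    using arg_cong[OF id_take_nth_drop[OF assms(1)], of concat] by simp
  moreover have "i - 1 - start j < length (R ! j)" "\<not> i - 1 < start j"
    using assms start_Suc[of j] by auto
  ultimately show ?thesis
    by (simp add: entry_def start_def nth_append diff_commute del: length_concat)
qed

lemma entry_first: "j < length R \<Longrightarrow> entry word (Suc (start j)) = hd (R ! j)"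
  using entry_eq[of j "Suc (start j)"] start_less_Suc[of j] nonempty[OF nth_mem]
  by (simp add: hd_conv_nth)

lemma entry_last: "j < length R \<Longrightarrow> entry word (start (Suc j)) = last (R ! j)"
  using entry_eq[of j "start (Suc j)"] start_less_Suc[of j] nonempty[OF nth_mem]
  by (simp add: last_conv_nth start_Suc)

lemma entry_decreasing:
  assumes "j < length R" "start j < i" "i < k" "k \<le> start (Suc j)"
  shows "entry word k < entry word i"
  using sorted_wrt_nth_less[OF decreasing[OF nth_mem[OF assms(1)]],
      of "i - start j - 1" "k - start j - 1"] assms
  by (simp add: entry_eq start_Suc)

lemma run_of_position:
  assumes "1 \<le> i" "i \<le> length word"
  obtains j where "j < length R" "start j < i" "i \<le> start (Suc j)"
proof -
  have "\<exists>k\<le>length R. (\<forall>m<k. \<not> i \<le> start m) \<and> i \<le> start k"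
    using assms by (intro ex_least_nat_le) (auto simp: start_0 start_ge_length)
  then obtain k where k: "k \<le> length R" "\<forall>m<k. \<not> i \<le> start m" "i \<le> start k" by blast
  then obtain j where "k = Suc j" using assms by (cases k) (auto simp: start_0)
  then show ?thesis using k that[of j] by auto
qed

lemma entry_le_hd:
  assumes "j < length R" "start j < i" "i \<le> start (Suc j)"
  shows "entry word i \<le> hd (R ! j)"
  using entry_decreasing[of j "Suc (start j)" i] entry_first[of j] assms
  by (cases "i = Suc (start j)") auto

lemma last_le_entry:
  assumes "j < length R" "start j < i" "i \<le> start (Suc j)"
  shows "last (R ! j) \<le> entry word i"
  using entry_decreasing[of j i "start (Suc j)"] entry_last[of j] assms
  by (cases "i = start (Suc j)") auto

text \<open>
  This is where increasing tops matter: the end of the run of position \<open>i\<close> lies above the end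
  of run \<open>j\<close>, and it is the least entry of its run.
\<close>

lemma last_less_later_entry:
  assumes "j < length R" "start (Suc j) < i" "i \<le> length word"
  shows "last (R ! j) < entry word i"
proof -
  obtain k where k: "k < length R" "start k < i" "i \<le> start (Suc k)"
    using run_of_position[of i] assms by auto
  have "j < k" using start_mono[of "Suc k" "Suc j"] k assms by (cases "j < k") auto
  then have "last (R ! j) < last (R ! k)"
    using sorted_wrt_nth_less[OF tops_increase, of j k] k(1) by simp
  also have "\<dots> \<le> entry word i" by (rule last_le_entry[OF k])
  finally show ?thesis .
qed

text \<open>
  When the next run starts too low, the present run steps over that value: it lies strictly
  below entry \<open>i\<close> and no entry of the run after \<open>i\<close> exceeds it. This one position yields both
  the occurrence of 31-2 and the point where two shadowlines meet.
\<close>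

lemma run_steps_over_next_head:
  assumes "Suc j < length R" "hd (R ! Suc j) < hd (R ! j)"
  obtains i where "start j < i" "i < start (Suc j)" "hd (R ! Suc j) < entry word i"
    "\<And>p. i < p \<Longrightarrow> p \<le> start (Suc j) \<Longrightarrow> entry word p \<le> hd (R ! Suc j)"
proof -
  define I where "I = {i. start j < i \<and> i \<le> start (Suc j) \<and> hd (R ! Suc j) < entry word i}"
  have "finite I" by (rule finite_subset[of _ "{..start (Suc j)}"]) (auto simp: I_def)
  moreover have "Suc (start j) \<in> I"
    using assms entry_first[of j] start_less_Suc[of j] by (simp add: I_def)
  ultimately have max: "Max I \<in> I" "\<And>i. i \<in> I \<Longrightarrow> i \<le> Max I"
    using Max_in[of I] Max_ge[of I] by blast+
  have "last (R ! j) < hd (R ! Suc j)"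
    using last_less_later_entry[of j "Suc (start (Suc j))"] entry_first[of "Suc j"]
      start_less_Suc[of "Suc j"] start_le_length[of "Suc (Suc j)"] assms(1) by simp
  then have "start (Suc j) \<notin> I" using entry_last[of j] assms(1) by (simp add: I_def)
  then have "Max I \<noteq> start (Suc j)" using max(1) by metis
  then show ?thesis
    using that[of "Max I"] max unfolding I_def
    by (smt (verit) le_neq_implies_less linorder_not_less mem_Collect_eq order.strict_trans)
qed

section \<open>Pattern avoidance in terms of runs\<close>

text \<open>
  The entries playing 3 and 4 ascend, so they lie in different runs. The end of the run of the 3
  lies before the 4 and below every later entry; it is not the 3 itself because the 2 is smaller
  than the 3.
\<close>

lemma word_avoids_3_bar1_42: "avoids_3_bar1_42 word"
  unfolding avoids_3_bar1_42_def
proof (intro allI impI, elim conjE)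
  fix i k assume a: "1 \<le> i" "i < k" "k + 1 \<le> length word"
    "entry word (k + 1) < entry word i" "entry word i < entry word k"
  obtain j where j: "j < length R" "start j < i" "i \<le> start (Suc j)"
    using run_of_position[of i] a by auto
  have "start (Suc j) < k"
  proof (rule ccontr)
    assume "\<not> start (Suc j) < k"
    then show False using entry_decreasing[of j i k] j a by simp
  qed
  moreover have "entry word (start (Suc j)) < entry word (k + 1)"
    using last_less_later_entry[of j "k + 1"] entry_last[of j] j a calculation by simp
  moreover have "i \<noteq> start (Suc j)" using calculation(2) a(4) by auto
  ultimately show "\<exists>p>i. p < k \<and> entry word p < entry word (k + 1)"
    using j by (intro exI[of _ "start (Suc j)"]) auto
qed

text \<open>
  If the heads increase, the head of the run containing the 2 serves as the 4. For the converse,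
  the descent at which run \<open>j\<close> steps over the head of the next run forms 31 with that head as 2,
  and all entries in between belong to the remainder of run \<open>j\<close>.
\<close>

lemma avoids_31_bar4_2_iff_heads_increase:
  assumes "distinct word"
  shows "avoids_31_bar4_2 word \<longleftrightarrow> sorted_wrt (<) (map hd R)"
proof
  assume heads: "sorted_wrt (<) (map hd R)"
  show "avoids_31_bar4_2 word"
    unfolding avoids_31_bar4_2_def
  proof (intro allI impI, elim conjE)
    fix i k assume a: "1 \<le> i" "i + 1 < k" "k \<le> length word"
      "entry word (i + 1) < entry word k" "entry word k < entry word i"
    obtain a where j: "a < length R" "start a < i" "i \<le> start (Suc a)"
      using run_of_position[of i] a by auto
    obtain b where b: "b < length R" "start b < k" "k \<le> start (Suc b)"
      using run_of_position[of k] a by auto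
    have i: "i + 1 \<le> start (Suc a)"
      using last_less_later_entry[of a "i + 1"] entry_last[of a] j a
      by (cases "i = start (Suc a)") auto
    have "start (Suc a) < k"
      using entry_decreasing[of a "i + 1" k] j a by (cases "start (Suc a) < k") auto
    then have "a < b" using start_mono[of "Suc b" "Suc a"] b by (cases "a < b") auto
    then have "start (Suc a) \<le> start b" "hd (R ! a) < hd (R ! b)"
      using start_mono[of "Suc a" b] sorted_wrt_nth_less[OF heads, of a b] b by auto
    then have "i + 1 < Suc (start b)" "entry word i < entry word (Suc (start b))"
      using i entry_le_hd[OF j] entry_first[of b] b by auto
    moreover have "Suc (start b) \<noteq> k" using calculation(2) a(5) by auto
    ultimately show "\<exists>p>i + 1. p < k \<and> entry word i < entry word p"
      using b by (intro exI[of _ "Suc (start b)"]) auto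
  qed
next
  assume avoids: "avoids_31_bar4_2 word"
  show "sorted_wrt (<) (map hd R)"
  proof (rule ccontr)
    assume "\<not> ?thesis"
    then obtain j where j: "Suc j < length R" "\<not> hd (R ! j) < hd (R ! Suc j)"
      by (auto simp: sorted_wrt_iff_nth_Suc_transp)
    define k where "k = Suc (start (Suc j))"
    have k: "entry word k = hd (R ! Suc j)" "k \<le> length word"
      using entry_first[of "Suc j"] start_less_Suc[of "Suc j"] start_le_length[of "Suc (Suc j)"] j
      by (auto simp: k_def)
    have neq: "entry word p \<noteq> entry word k" if "1 \<le> p" "p < k" for p
      using that assms k(2) by (simp add: entry_def nth_eq_iff_index_eq)
    have "hd (R ! j) \<noteq> hd (R ! Suc j)"
      using neq[of "Suc (start j)"] entry_first[of j] k j start_less_Suc[of j] by (simp add: k_def)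
    with j obtain i where i: "start j < i" "i < start (Suc j)" "hd (R ! Suc j) < entry word i"
      "\<And>p. i < p \<Longrightarrow> p \<le> start (Suc j) \<Longrightarrow> entry word p \<le> hd (R ! Suc j)"
      using run_steps_over_next_head[of j] by (metis linorder_neqE_nat)
    have "entry word (i + 1) < entry word k"
      using i(4)[of "i + 1"] neq[of "i + 1"] i(1-3) k by (simp add: k_def)
    then obtain p where p: "i + 1 < p" "p < k" "entry word i < entry word p"
      using avoids i k unfolding avoids_31_bar4_2_def
      by (metis One_nat_def Suc_eq_plus1 Suc_leI Suc_mono gr_zeroI k_def not_less0
          order.strict_trans1 zero_le)
    then show False using i(3) i(4)[of p] by (simp add: k_def)
  qed
qed

end

lemma avoids_3_bar1_42_prefix:
  assumes "avoids_3_bar1_42 (\<sigma> @ \<rho>)"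
  shows "avoids_3_bar1_42 \<sigma>"
  unfolding avoids_3_bar1_42_def
proof (intro allI impI, elim conjE)
  fix i j assume a: "1 \<le> i" "i < j" "j + 1 \<le> length \<sigma>"
    "entry \<sigma> (j + 1) < entry \<sigma> i" "entry \<sigma> i < entry \<sigma> j"
  have "entry (\<sigma> @ \<rho>) k = entry \<sigma> k" if "k \<le> j + 1" for k
    using that a by (auto simp: entry_def nth_append)
  then show "\<exists>p>i. p < j \<and> entry \<sigma> p < entry \<sigma> (j + 1)"
    using assms[unfolded avoids_3_bar1_42_def, rule_format, of i j] a by auto
qed

text \<open>
  Adding the entries one by one, a new entry \<open>c\<close> starts a run or extends the last run \<open>r\<close>. The only
  obstacle is \<open>c\<close> falling below the end of the previous run. That end, followed by the end of \<open>r\<close>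
  and \<open>c\<close>, would then be an occurrence of 3-42, and everything in between belongs to \<open>r\<close> and so
  exceeds \<open>c\<close>.
\<close>

lemma avoids_3_bar1_42_imp_rising_runs:
  assumes "distinct \<sigma>" "avoids_3_bar1_42 \<sigma>"
  shows "\<exists>R. rising_runs R \<and> concat R = \<sigma>"
  using assms
proof (induction \<sigma> rule: rev_induct)
  case Nil
  then show ?case by (intro exI[of _ "[]"]) (simp add: rising_runs_def)
next
  case (snoc c \<sigma>)
  then obtain R where R: "rising_runs R" "concat R = \<sigma>"
    using avoids_3_bar1_42_prefix by (metis distinct_append)
  show ?case
  proof (cases R rule: rev_cases)
    case Nil
    then show ?thesis
      using R by (intro exI[of _ "[[c]]"]) (simp add: rising_runs_def)
  next
    case (snoc Q r)
    have r: "rising_runs Q" "r \<noteq> []" "sorted_wrt (>) r" "\<forall>q\<in>set Q. last q < last r"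
      using R(1) by (auto simp: snoc rising_runs_snoc)
    show ?thesis
    proof (cases "last r < c")
      case True
      then have "\<forall>q\<in>set R. last q < c" using r(4) by (auto simp: snoc)
      then have "rising_runs (R @ [[c]])" using R(1) by (simp add: rising_runs_snoc[of R])
      then show ?thesis using R(2) by (intro exI[of _ "R @ [[c]]"]) simp
    next
      case False
      have "last r \<noteq> c" using snoc.prems(1) R(2) r(2) snoc by auto
      with False have c: "c < last r" by simp
      have low: "last q < c" if q: "q \<in> set Q" for q
      proof (rule ccontr)
        assume "\<not> last q < c"
        obtain P t where Q: "Q = P @ [t]" using q by (cases Q rule: rev_cases) auto
        have t: "t \<noteq> []" "last q \<le> last t"
          using r(1) q by (auto simp: Q rising_runs_snoc)
        have "t \<in> set R" by (simp add: snoc Q)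
        then have "last t \<in> set \<sigma>" using R(2) t(1) by (auto intro!: bexI[of _ t])
        then have "c \<noteq> last t" using snoc.prems(1) by auto
        then have ct: "c < last t" using t \<open>\<not> last q < c\<close> by simp
        define i where "i = length (concat Q)"
        have \<sigma>: "\<sigma> = concat Q @ r" using R(2) snoc by simp
        have i: "1 \<le> i" using t by (cases t) (auto simp: i_def Q)
        have "entry (\<sigma> @ [c]) i = last (concat Q)"
          using i t(1) by (auto simp: entry_def \<sigma> i_def nth_append last_conv_nth Q)
        then have ei: "entry (\<sigma> @ [c]) i = last t" using t by (simp add: Q)
        have ej: "entry (\<sigma> @ [c]) (length \<sigma>) = last r"
        proof -
          have "\<sigma> \<noteq> []" "last \<sigma> = last r" using r(2) by (simp_all add: \<sigma>)
          then show ?thesis by (simp add: entry_def nth_append last_conv_nth[of \<sigma>])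
        qed
        have ec: "entry (\<sigma> @ [c]) (length \<sigma> + 1) = c" by (simp add: entry_def)
        have "\<exists>p>i. p < length \<sigma> \<and> entry (\<sigma> @ [c]) p < entry (\<sigma> @ [c]) (length \<sigma> + 1)"
          using snoc.prems(2)[unfolded avoids_3_bar1_42_def, rule_format, of i "length \<sigma>"]
            i ei ej ec ct r
          by (auto simp: Q \<sigma> i_def simp del: length_concat)
        then obtain p where p: "i < p" "p < length \<sigma>" "entry (\<sigma> @ [c]) p < c"
          using ec by auto
        have "entry (\<sigma> @ [c]) p = r ! (p - 1 - i)"
          using p by (auto simp: entry_def \<sigma> i_def nth_append simp del: length_concat)
        moreover have "p - 1 - i < length r" using p by (auto simp: \<sigma> i_def simp del: length_concat)
        ultimately have "last r \<le> entry (\<sigma> @ [c]) p" using decreasing_last_le[OF r(3)] by simp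
        then show False using p c by simp
      qed
      have "\<forall>x\<in>set r. c < x" using decreasing_last_le[OF r(3)] c by (meson less_le_trans)
      then have "rising_runs (Q @ [r @ [c]])"
        using r low by (auto simp: rising_runs_snoc sorted_wrt_append)
      then show ?thesis using R(2) snoc by (intro exI[of _ "Q @ [r @ [c]]"]) simp
    qed
  qed
qed

section \<open>Shadowlines\<close>

text \<open>
  A finite union of shadows is closed, and its interior consists of the points strictly southwest
  of some point of \<open>A\<close>.
\<close>

lemma shadowline_iff:
  assumes "finite A"
  shows "z \<in> shadowline A \<longleftrightarrow>
    (\<exists>p\<in>A. fst z \<le> fst p \<and> snd z \<le> snd p) \<and> \<not> (\<exists>p\<in>A. fst z < fst p \<and> snd z < snd p)"
proof -
  define U where "U = (\<Union>p\<in>A. shadow p)"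
  have shadow_eq: "shadow p = {..fst p} \<times> {..snd p}" for p by (auto simp: shadow_def)
  have "closed U" unfolding U_def shadow_eq using assms by (intro closed_UN) (auto intro: closed_Times)
  have "interior U = (\<Union>p\<in>A. {..<fst p} \<times> {..<snd p})"
  proof (rule interior_unique)
    show "(\<Union>p\<in>A. {..<fst p} \<times> {..<snd p}) \<subseteq> U" by (force simp: U_def shadow_eq)
    show "open (\<Union>p\<in>A. {..<fst p} \<times> {..<snd p})" by (auto intro!: open_Times)
  next
    fix T assume T: "T \<subseteq> U" "open T"
    show "T \<subseteq> (\<Union>p\<in>A. {..<fst p} \<times> {..<snd p})"
    proof
      fix w assume "w \<in> T"
      obtain x y where w: "w = (x, y)" by (cases w)
      obtain B C where BC: "open B" "open C" "w \<in> B \<times> C" "B \<times> C \<subseteq> T"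
        using open_prod_elim[OF T(2) \<open>w \<in> T\<close>] by metis
      have "x \<in> B" "y \<in> C" using BC(3) w by auto
      obtain x' where x': "x' \<in> B" "x < x'"
        using open_right[OF BC(1) \<open>x \<in> B\<close>, of "x + 1"] dense
        by (metis atLeastLessThan_iff less_add_one less_imp_le subsetD)
      obtain y' where y': "y' \<in> C" "y < y'"
        using open_right[OF BC(2) \<open>y \<in> C\<close>, of "y + 1"] dense
        by (metis atLeastLessThan_iff less_add_one less_imp_le subsetD)
      have "(x', y') \<in> U" using BC(4) T(1) x' y' by blast
      then show "w \<in> (\<Union>p\<in>A. {..<fst p} \<times> {..<snd p})"
        using x' y' w by (force simp: U_def shadow_eq)
    qed
  qed
  then have "z \<in> interior U \<longleftrightarrow> (\<exists>p\<in>A. fst z < fst p \<and> snd z < snd p)"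
    by (cases z) auto
  moreover have "z \<in> U \<longleftrightarrow> (\<exists>p\<in>A. fst z \<le> fst p \<and> snd z \<le> snd p)"
    by (cases z) (simp add: U_def shadow_eq)
  ultimately show ?thesis
    using \<open>closed U\<close> by (simp add: shadowline_def U_def[symmetric] frontier_def)
qed

context rising_runs
begin

definition point :: "nat \<Rightarrow> real \<times> real"
  where "point i = (real i, real (entry word i))"

lemma point_coords [simp]: "fst (point i) = real i" "snd (point i) = real (entry word i)"
  by (simp_all add: point_def)

abbreviation run_points :: "nat \<Rightarrow> (real \<times> real) set"
  where "run_points j \<equiv> point ` {start j<..start (Suc j)}"

abbreviation points_from_run :: "nat \<Rightarrow> (real \<times> real) set"
  where "points_from_run j \<equiv> point ` {start j<..length word}"

lemma point_eq_iff [simp]: "point i = point k \<longleftrightarrow> i = k"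
  by (auto simp: point_def)

text \<open>
  Within a run no point lies southwest of another, while the end of run \<open>j\<close> lies southwest of
  every point of the later runs.
\<close>

lemma shadow_minimal_points_from_run:
  assumes "j < length R"
  shows "shadow_minimal (points_from_run j) = run_points j"
proof (intro equalityI subsetI)
  fix z assume "z \<in> shadow_minimal (points_from_run j)"
  then obtain i where i: "z = point i" "start j < i" "i \<le> length word"
    "shadow (point i) \<inter> points_from_run j = {point i}"
    by (auto simp: shadow_minimal_def)
  have "i \<le> start (Suc j)"
  proof (rule ccontr)
    assume "\<not> i \<le> start (Suc j)"
    then have "point (start (Suc j)) \<in> shadow (point i) \<inter> points_from_run j"
      using last_less_later_entry[of j i] entry_last[of j] start_less_Suc[of j] assms i(3)
        start_le_length[of "Suc j"]
      by (auto simp: shadow_def point_def)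
    then show False using i(4) \<open>\<not> i \<le> start (Suc j)\<close> by auto
  qed
  then show "z \<in> run_points j" using i by auto
next
  fix z assume "z \<in> run_points j"
  then obtain i where i: "z = point i" "start j < i" "i \<le> start (Suc j)" by auto
  have "k = i" if "start j < k" "point k \<in> shadow (point i)" for k
    using that entry_decreasing[of j k i] assms i by (force simp: shadow_def point_def)
  moreover have "point i \<in> shadow (point i)" by (simp add: shadow_def point_def)
  moreover have "i \<le> length word" using i start_le_length[of "Suc j"] by simp
  ultimately show "z \<in> shadow_minimal (points_from_run j)"
    using i by (auto simp: shadow_minimal_def)
qed

text \<open>
  The points of a run lie on its shadowline, as none is strictly northeast of another; later
  points lie to the right of all the shadows.
\<close>

lemma point_in_run_shadowline_iff:
  assumes "j < length R" "start j < i"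
  shows "point i \<in> shadowline (run_points j) \<longleftrightarrow> i \<le> start (Suc j)"
  using assms entry_decreasing[of j i] by (force simp: shadowline_iff)

lemma remaining_word: "remaining word j = points_from_run j"
proof (induction j)
  case 0
  show ?case by (auto simp: plot_def point_def start_0 image_iff Bex_def)
next
  case (Suc j)
  show ?case
  proof (cases "j < length R")
    case True
    then show ?thesis
      using Suc point_in_run_shadowline_iff[OF True] start_less_Suc[OF True]
      by (auto simp: shadow_minimal_points_from_run)
  next
    case False
    then show ?thesis using Suc by (simp add: start_ge_length)
  qed
qed

lemma shadow_diagram_word:
  "shadow_diagram word = (\<lambda>j. shadowline (run_points j)) ` {..<length R}"
proof -
  have "remaining word j \<noteq> {} \<longleftrightarrow> j < length R" for j
    using start_less_Suc[of j] start_le_length[of "Suc j"] start_ge_length[of j]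
    by (cases "j < length R") (auto simp: remaining_word simp del: length_concat)
  moreover have "shadowline_of word j = shadowline (run_points j)" if "j < length R" for j
    using that by (simp add: shadowline_of_def remaining_word shadow_minimal_points_from_run)
  ultimately show ?thesis
    unfolding shadow_diagram_def by (auto simp: image_iff)
qed

text \<open>
  The first point of run \<open>b\<close> is strictly northeast of every point of run \<open>a\<close>, so all shadows of
  run \<open>a\<close> lie in the interior of the shadow of that point.
\<close>

lemma run_shadowlines_disjoint:
  assumes "a < b" "b < length R" "hd (R ! a) < hd (R ! b)"
  shows "disjnt (shadowline (run_points a)) (shadowline (run_points b))"
proof -
  have "z \<notin> shadowline (run_points b)" if "z \<in> shadowline (run_points a)" for z
  proof -
    obtain i where i: "start a < i" "i \<le> start (Suc a)"
      "fst z \<le> real i" "snd z \<le> real (entry word i)"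
      using \<open>z \<in> shadowline (run_points a)\<close> by (auto simp: shadowline_iff)
    define k where "k = Suc (start b)"
    have "i < k" using i start_mono[of "Suc a" b] assms(1) by (simp add: k_def)
    moreover have "entry word i < entry word k"
      using entry_le_hd[of a i] i assms entry_first[of b] by (simp add: k_def)
    moreover have "point k \<in> run_points b" using start_less_Suc[OF assms(2)] by (simp add: k_def)
    ultimately have "\<exists>p\<in>run_points b. fst z < fst p \<and> snd z < snd p"
      using i by (intro bexI[of _ "point k"]) auto
    then show ?thesis by (simp add: shadowline_iff)
  qed
  then show ?thesis by (auto simp: disjnt_def)
qed

text \<open>
  The common point is in the column of the position \<open>i\<close> at which run \<open>j\<close> steps over the head of
  the next run, at the height of that head.
\<close>

lemma run_shadowlines_meet:
  assumes "Suc j < length R" "hd (R ! Suc j) < hd (R ! j)"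
  shows "\<not> disjnt (shadowline (run_points j)) (shadowline (run_points (Suc j)))"
proof -
  obtain i where i: "start j < i" "i < start (Suc j)" "hd (R ! Suc j) < entry word i"
    "\<And>p. i < p \<Longrightarrow> p \<le> start (Suc j) \<Longrightarrow> entry word p \<le> hd (R ! Suc j)"
    using run_steps_over_next_head[OF assms] by metis
  define z where "z = (real i, real (hd (R ! Suc j)))"
  have "z \<in> shadowline (run_points j)"
    using i by (force simp: shadowline_iff z_def)
  moreover have "z \<in> shadowline (run_points (Suc j))"
  proof -
    have "\<exists>p\<in>run_points (Suc j). fst z \<le> fst p \<and> snd z \<le> snd p"
      using start_less_Suc[OF assms(1)] entry_first[OF assms(1)] i
      by (intro bexI[of _ "point (Suc (start (Suc j)))"]) (auto simp: z_def)
    moreover have "\<not> snd z < snd p" if "p \<in> run_points (Suc j)" for p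
      using that entry_le_hd[OF assms(1)] by (auto simp: z_def not_less)
    ultimately show ?thesis by (auto simp: shadowline_iff)
  qed
  ultimately show ?thesis by (auto simp: disjnt_def)
qed

text \<open>
  A shadow diagram is a set of lines, so coinciding lines would count as one and escape the test
  of pairwise disjointness. The last point of run \<open>b\<close> tells the two lines apart.
\<close>

lemma run_shadowlines_distinct:
  assumes "a < b" "b < length R"
  shows "shadowline (run_points a) \<noteq> shadowline (run_points b)"
proof -
  define k where "k = start (Suc b)"
  have k: "start b < k" "start (Suc a) < k" "start a < k"
    using start_less_Suc[OF assms(2)] start_mono[of "Suc a" b] start_mono[of a b] assms
    by (auto simp: k_def)
  have "point k \<in> shadowline (run_points b)"
    using point_in_run_shadowline_iff[of b k] assms k by (simp add: k_def)
  moreover have "point k \<notin> shadowline (run_points a)"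
    using point_in_run_shadowline_iff[of a k] assms k by simp
  ultimately show ?thesis by metis
qed

lemma non_intersecting_iff_heads_increase:
  assumes "distinct word"
  shows "non_intersecting (shadow_diagram word) \<longleftrightarrow> sorted_wrt (<) (map hd R)"
proof
  assume heads: "sorted_wrt (<) (map hd R)"
  have less: "disjnt (shadowline (run_points a)) (shadowline (run_points b))"
    if "a < b" "b < length R" for a b
    using run_shadowlines_disjoint[OF that] sorted_wrt_nth_less[OF heads, of a b] that by simp
  show "non_intersecting (shadow_diagram word)"
    unfolding non_intersecting_def shadow_diagram_word pairwise_image
  proof (rule pairwiseI, rule impI)
    fix a b assume "a \<in> {..<length R}" "b \<in> {..<length R}" "a \<noteq> b"
    then consider "a < b" "b < length R" | "b < a" "a < length R" by fastforce
    then show "disjnt (shadowline (run_points a)) (shadowline (run_points b))"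
    proof cases
      case 1
      then show ?thesis by (rule less)
    next
      case 2
      then show ?thesis by (rule disjnt_sym[OF less])
    qed
  qed
next
  assume disj: "non_intersecting (shadow_diagram word)"
  have "hd (R ! j) < hd (R ! Suc j)" if j: "Suc j < length R" for j
  proof -
    have "disjnt (shadowline (run_points j)) (shadowline (run_points (Suc j)))"
      using disj run_shadowlines_distinct[of j "Suc j"] j
      by (simp add: non_intersecting_def shadow_diagram_word pairwise_def)
    then have "\<not> hd (R ! Suc j) < hd (R ! j)" using run_shadowlines_meet[OF j] by blast
    moreover have "hd (R ! j) \<noteq> hd (R ! Suc j)"
    proof -
      have "start j < start (Suc j)" "start (Suc j) < length word"
        using start_less_Suc[of j] start_less_Suc[of "Suc j"] start_le_length[of "Suc (Suc j)"] j
        by auto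
      then have "entry word (Suc (start j)) \<noteq> entry word (Suc (start (Suc j)))"
        using assms by (simp add: entry_def nth_eq_iff_index_eq)
      then show ?thesis using entry_first[of j] entry_first[of "Suc j"] j by simp
    qed
    ultimately show ?thesis by simp
  qed
  then show "sorted_wrt (<) (map hd R)" by (simp add: sorted_wrt_iff_nth_Suc_transp)
qed

end

section \<open>Reverse patience words with non-intersecting shadow diagrams\<close>

theorem theorem3p6:
  fixes n :: nat
  assumes "n \<ge> 1"
  shows "S_avoid n =
           {\<sigma> \<in> reverse_patience_words n. non_intersecting (shadow_diagram \<sigma>)} \<and>
         (\<forall>\<sigma> \<in> S_avoid n.
            sorted_wrt (<) (bottom_row (insertion_piles \<sigma>)) \<and>
            sorted_wrt (<) (bottom_row (recording_piles \<sigma>)))"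
proof -
  have rpw: "\<sigma> \<in> reverse_patience_words n \<longleftrightarrow>
      \<sigma> \<in> permutations_of_set {1..n} \<and> avoids_3_bar1_42 \<sigma>" for \<sigma>
    using avoids_3_bar1_42_imp_rising_runs[of \<sigma>] rising_runs.word_avoids_3_bar1_42
    by (auto simp: reverse_patience_words_eq dest: permutations_of_setD)
  have heads: "avoids_31_bar4_2 \<sigma> \<longleftrightarrow> non_intersecting (shadow_diagram \<sigma>)"
    if "\<sigma> \<in> reverse_patience_words n" for \<sigma>
    using that rising_runs.avoids_31_bar4_2_iff_heads_increase
      rising_runs.non_intersecting_iff_heads_increase
    by (auto simp: reverse_patience_words_eq dest: permutations_of_setD)
  have S: "S_avoid n = {\<sigma> \<in> reverse_patience_words n. avoids_31_bar4_2 \<sigma>}"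
    by (auto simp: S_avoid_def rpw)
  have "sorted_wrt (<) (bottom_row (insertion_piles \<sigma>)) \<and>
        sorted_wrt (<) (bottom_row (recording_piles \<sigma>))" if \<sigma>: "\<sigma> \<in> S_avoid n" for \<sigma>
  proof -
    obtain R where R: "rising_runs R" "\<sigma> = concat R" "distinct \<sigma>" "avoids_31_bar4_2 \<sigma>"
      using \<sigma> by (auto simp: S reverse_patience_words_eq dest: permutations_of_setD)
    obtain P where P: "eps \<sigma> = (R, P)" "sorted_wrt (<) (map hd P)"
      using eps_concat[OF R(1)] R(2) by blast
    have "sorted_wrt (<) (map hd R)"
      using rising_runs.avoids_31_bar4_2_iff_heads_increase[OF R(1)] R by simp
    then show ?thesis
      using P by (simp add: bottom_row_def insertion_piles_def recording_piles_def)
  qed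
  then show ?thesis using S heads by blast
qed

end
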